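(* Let $C$ be a smooth cubic curve in the complex projective plane $\mathbb{P}^2$. Then the surface $X=\mathbb{P}^2\setminus C$ is dominable by $\mathbb{C}^2$.
   Context: A complex surface $X$ is dominable by $\mathbb{C}^2$ if there is a holomorphic map $F:\mathbb{C}^2\to X$ whose Jacobian determinant is not identically zero. *)

theory Defs
  imports "HOL-Analysis.Analysis"
begin

definition proportional :: "complex^3 \<Rightarrow> complex^3 \<Rightarrow> bool" where
  "proportional x y \<longleftrightarrow> x \<noteq> 0 \<and> y \<noteq> 0 \<and> (\<exists>c. c \<noteq> 0 \<and> x = c *s y)"

lemma part_equivp_proportional: "part_equivp proportional"
proof (rule part_equivpI)
  have "proportional (axis 1 1) (axis 1 1)"
    by (auto simp: proportional_def axis_eq_0_iff intro!: exI[of _ 1])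
  then show "\<exists>x. proportional x x" by blast
  show "symp proportional"
  proof (rule sympI)
    fix x y assume "proportional x y"
    then obtain c where c: "x \<noteq> 0" "y \<noteq> 0" "c \<noteq> 0" "x = c *s y"
      by (auto simp: proportional_def)
    then have "y = inverse c *s x" by (simp add: vector_smult_assoc)
    with c show "proportional y x"
      unfolding proportional_def by (metis nonzero_imp_inverse_nonzero)
  qed
  show "transp proportional"
  proof (rule transpI)
    fix x y z assume "proportional x y" "proportional y z"
    then show "proportional x z"
      unfolding proportional_def by (metis mult_eq_0_iff vector_smult_assoc)
  qed
qed

quotient_type cp2 = "complex^3" / partial: proportional
  by (rule part_equivp_proportional)

text \<open>The topology is the quotient topology from the open subset of nonzero vectors.
  Note that \<^term>\<open>abs_cp2 x\<close> is meaningful only for nonzero \<open>x\<close>.\<close>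

instantiation cp2 :: topological_space
begin

definition open_cp2 :: "cp2 set \<Rightarrow> bool" where
  "open_cp2 U \<longleftrightarrow> open {x. x \<noteq> 0 \<and> abs_cp2 x \<in> U}"

instance
proof
  have "{x::complex^3. x \<noteq> 0 \<and> abs_cp2 x \<in> UNIV} = - {0}" by auto
  then show "open (UNIV :: cp2 set)"
    by (simp only: open_cp2_def open_Compl[OF closed_singleton])
next
  fix S T :: "cp2 set"
  assume *: "open S" "open T"
  have "{x. x \<noteq> 0 \<and> abs_cp2 x \<in> S \<inter> T}
      = {x. x \<noteq> 0 \<and> abs_cp2 x \<in> S} \<inter> {x. x \<noteq> 0 \<and> abs_cp2 x \<in> T}" by auto
  then show "open (S \<inter> T)"
    using open_Int[OF *[unfolded open_cp2_def]] by (simp only: open_cp2_def)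
next
  fix K :: "cp2 set set"
  assume *: "\<forall>S\<in>K. open S"
  have "{x. x \<noteq> 0 \<and> abs_cp2 x \<in> \<Union>K}
      = (\<Union>S\<in>K. {x. x \<noteq> 0 \<and> abs_cp2 x \<in> S})" by auto
  then show "open (\<Union>K)"
    using open_UN[OF *[unfolded open_cp2_def]] by (simp only: open_cp2_def)
qed

end

lift_definition nonzero_coord :: "3 \<Rightarrow> cp2 \<Rightarrow> bool" is "\<lambda>i x. x $ i \<noteq> 0"
  by (auto simp: proportional_def)

definition affine_part :: "3 \<Rightarrow> cp2 set" where
  "affine_part i = {p. nonzero_coord i p}"

text \<open>Arithmetic on the index type \<^typ>\<open>3\<close> is modulo 3, so \<open>i + 1\<close> and \<open>i + 2\<close> are the two
  indices other than \<open>i\<close>. This is the standard affine coordinate system on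
  \<^term>\<open>affine_part i\<close>; outside that set its values are irrelevant.\<close>

lift_definition affine_chart :: "3 \<Rightarrow> cp2 \<Rightarrow> complex^2" is
  "\<lambda>i x. vector [x $ (i + 1) / x $ i, x $ (i + 2) / x $ i]"
  by (auto simp: proportional_def)

definition holomorphic_vec_on :: "(complex^'n \<Rightarrow> complex^'m) \<Rightarrow> (complex^'n) set \<Rightarrow> bool" where
  "holomorphic_vec_on f S \<longleftrightarrow> (\<forall>z\<in>S. \<exists>A :: complex^'n^'m. (f has_derivative (\<lambda>v. A *v v)) (at z))"

text \<open>By continuity the preimages of the affine parts are open, so the two-sided
  derivatives in \<^const>\<open>holomorphic_vec_on\<close> are meaningful.\<close>

definition holomorphic_to_cp2 :: "(complex^2 \<Rightarrow> cp2) \<Rightarrow> bool" where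
  "holomorphic_to_cp2 F \<longleftrightarrow> continuous_on UNIV F \<and>
     (\<forall>i. holomorphic_vec_on (affine_chart i \<circ> F) (F -` affine_part i))"

text \<open>The Jacobian determinant, taken in the chart \<open>i\<close>, is a complex determinant: the (real)
  Frechet derivative of a holomorphic map is complex linear, and \<^const>\<open>jacobian\<close> is its
  complex matrix. Whether it vanishes at \<open>z\<close> does not depend on the chart around \<open>F z\<close>.
  The predicate is meant for open \<open>X\<close>.\<close>

definition dominable_by_C2 :: "cp2 set \<Rightarrow> bool" where
  "dominable_by_C2 X \<longleftrightarrow> (\<exists>F. holomorphic_to_cp2 F \<and> range F \<subseteq> X \<and>
     (\<exists>z i. F z \<in> affine_part i \<and> det (jacobian (affine_chart i \<circ> F) (at z)) \<noteq> 0))"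

text \<open>A form of degree \<open>d\<close> in three variables is given by its coefficients, indexed by the
  exponent vectors \<open>m\<close> of total degree \<open>d\<close>; other values of the coefficient function are
  ignored.\<close>

definition exponents :: "nat \<Rightarrow> (3 \<Rightarrow> nat) set" where
  "exponents d = {m. sum m UNIV = d}"

definition form_eval :: "nat \<Rightarrow> ((3 \<Rightarrow> nat) \<Rightarrow> complex) \<Rightarrow> complex^3 \<Rightarrow> complex" where
  "form_eval d a x = (\<Sum>m\<in>exponents d. a m * (\<Prod>i\<in>UNIV. x $ i ^ m i))"

definition form_partial ::
    "nat \<Rightarrow> ((3 \<Rightarrow> nat) \<Rightarrow> complex) \<Rightarrow> 3 \<Rightarrow> complex^3 \<Rightarrow> complex" where
  "form_partial d a k x = (\<Sum>m\<in>exponents d.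
     a m * (of_nat (m k) * x $ k ^ (m k - 1) * (\<Prod>i\<in>UNIV - {k}. x $ i ^ m i)))"

lemma finite_exponents: "finite (exponents d)"
proof (rule finite_subset)
  show "exponents d \<subseteq> (UNIV :: 3 set) \<rightarrow>\<^sub>E {..d}"
  proof
    fix m :: "3 \<Rightarrow> nat" assume "m \<in> exponents d"
    then have "m i \<le> d" for i
      unfolding exponents_def using member_le_sum[of i UNIV m] by simp
    then show "m \<in> UNIV \<rightarrow>\<^sub>E {..d}" by (simp add: PiE_def)
  qed
qed (rule finite_PiE, simp_all)

lemma form_eval_scale: "form_eval d a (c *s x) = c ^ d * form_eval d a x"
proof -
  have "(\<Prod>i\<in>UNIV. (c *s x) $ i ^ m i) = c ^ d * (\<Prod>i\<in>UNIV. x $ i ^ m i)"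
    if "m \<in> exponents d" for m :: "3 \<Rightarrow> nat"
  proof -
    have "(\<Prod>i\<in>UNIV. (c *s x) $ i ^ m i) = (\<Prod>i\<in>UNIV. c ^ m i) * (\<Prod>i\<in>UNIV. x $ i ^ m i)"
      by (simp only: vector_smult_component power_mult_distrib prod.distrib)
    also have "(\<Prod>i\<in>UNIV. c ^ m i) = c ^ d"
      using that unfolding exponents_def by (auto simp only: mem_Collect_eq power_sum)
    finally show ?thesis .
  qed
  note scale = this
  show ?thesis
    unfolding form_eval_def sum_distrib_left
    by (intro sum.cong refl) (simp only: scale mult.left_commute)
qed

lift_definition form_vanishes_at :: "nat \<Rightarrow> ((3 \<Rightarrow> nat) \<Rightarrow> complex) \<Rightarrow> cp2 \<Rightarrow> bool" is
  "\<lambda>d a x. form_eval d a x = 0"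
  by (auto simp: proportional_def form_eval_scale)

definition plane_curve :: "nat \<Rightarrow> ((3 \<Rightarrow> nat) \<Rightarrow> complex) \<Rightarrow> cp2 set" where
  "plane_curve d a = {p. form_vanishes_at d a p}"

definition nonsingular_form :: "nat \<Rightarrow> ((3 \<Rightarrow> nat) \<Rightarrow> complex) \<Rightarrow> bool" where
  "nonsingular_form d a \<longleftrightarrow>
     (\<forall>x. x \<noteq> 0 \<longrightarrow> form_eval d a x = 0 \<longrightarrow> (\<exists>k. form_partial d a k x \<noteq> 0))"

text \<open>The zero form is not nonsingular, so it needs no separate exclusion here.\<close>

definition smooth_cubic_curve :: "cp2 set \<Rightarrow> bool" where
  "smooth_cubic_curve C \<longleftrightarrow> (\<exists>a. nonsingular_form 3 a \<and> C = plane_curve 3 a)"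

end

theory Submission
  imports Defs "HOL-Computational_Algebra.Fundamental_Theorem_Algebra"
begin

text \<open>Let \<open>f = 0\<close> be the equation of the cubic. A holomorphic map from \<open>\<complex>\<^sup>2\<close> to the affine surface \<open>f = 1\<close> in
  \<open>\<complex>\<^sup>3\<close> can be projected to the plane and then misses the curve; the surface is in fact the threefold
  cyclic cover of the complement. So it suffices to dominate this surface.

  A nonsingular cubic has a flex, and the line tangent there is a line on which \<open>f\<close> restricts to the cube
  of a linear form. This gives linear coordinates with \<open>f = y\<^sup>3 - x\<^sup>2 z + a y z\<^sup>2 + b z\<^sup>3\<close>
  (\<open>nonsingular_cubic_weierstrass_form\<close>). The existence of a flex is obtained by elimination: starting from any
  point of the curve and its tangent line, the lines on which \<open>f\<close> is a cube are governed by one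
  polynomial in one variable, and the fundamental theorem of algebra supplies a root
  (\<open>flex_line_parameters\<close>).

  The surface \<open>f = 1\<close> then contains the line \<open>y = 1, z = 0\<close>. Every plane \<open>y = 1 + t z\<close> through this line cuts
  the surface in a residual conic, and the equation of that conic is the Hamiltonian of a vector field on the
  plane whose coefficients are affine linear. The flow is therefore complete and entire. Each conic meets the line
  in points with \<open>x\<^sup>2 = 3 t\<close>, so with \<open>t = 3 u\<^sup>2\<close> the point of the line at \<open>x = 3 u\<close> lies on the conic.
  Flowing from this point for the time \<open>s\<close> defines an entire map of \<open>(s, u)\<close> into the surface
  (\<open>conic_flow_in_surface\<close>). It is written with \<open>cosh (s * sqrt \<delta>)\<close> and
  \<open>sinh (s * sqrt \<delta>) / sqrt \<delta>\<close>, which are entire in \<open>s\<close> and \<open>\<delta>\<close>, where \<open>\<delta>\<close> is a polynomial in \<open>u\<close>. At \<open>s = 0\<close> and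
  \<open>u \<noteq> 0\<close> the directions of the line and of the conic are distinct, so the map is nondegenerate
  (\<open>conic_flow_derivative\<close>).\<close>

section \<open>Cubic forms up to linear change of coordinates\<close>

text \<open>The coefficient tensor \<open>t\<close> is not required to be symmetric, so it is not unique. In return, any
  product of three linear functionals is a cubic form at once, and this is what makes the notion
  visibly stable under linear substitutions.\<close>

definition cubic_form :: "(complex^3 \<Rightarrow> complex) \<Rightarrow> bool" where
  "cubic_form f \<longleftrightarrow> (\<exists>t. \<forall>x.
     f x = (\<Sum>i\<in>UNIV. \<Sum>j\<in>UNIV. \<Sum>k\<in>UNIV. t i j k * (x $ i * x $ j * x $ k)))"

text \<open>Nonsingularity is phrased through directional derivatives, since the partial derivatives of a form
  depend on the basis whereas this condition does not.\<close>

definition nonsingular_cone :: "(complex^3 \<Rightarrow> complex) \<Rightarrow> bool" where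
  "nonsingular_cone f \<longleftrightarrow> (\<forall>x. x \<noteq> 0 \<longrightarrow> f x = 0 \<longrightarrow>
     (\<exists>w. \<not> ((\<lambda>h. f (x + h *s w)) has_field_derivative 0) (at 0)))"

definition linearly_equivalent ::
    "(complex^3 \<Rightarrow> complex) \<Rightarrow> (complex^3 \<Rightarrow> complex) \<Rightarrow> bool" where
  "linearly_equivalent f g \<longleftrightarrow> (\<exists>A :: complex^3^3. invertible A \<and> (\<forall>x. g x = f (A *v x)))"

lemma linearly_equivalent_refl: "linearly_equivalent f f"
  unfolding linearly_equivalent_def
  by (intro exI[of _ "mat 1"]) (simp add: invertible_def exI[of _ "mat 1"])

lemma linearly_equivalent_trans:
  assumes "linearly_equivalent f g" "linearly_equivalent g h"
  shows "linearly_equivalent f h"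
proof -
  obtain A B :: "complex^3^3" where "invertible A" "invertible B"
    and "\<And>x. g x = f (A *v x)" "\<And>x. h x = g (B *v x)"
    using assms by (auto simp: linearly_equivalent_def)
  then show ?thesis
    unfolding linearly_equivalent_def
    by (intro exI[of _ "A ** B"]) (simp add: invertible_mult matrix_vector_mul_assoc)
qed

text \<open>Every normalization below is a substitution of this kind, composed with the ones made before it.\<close>

lemma linear_substitution:
  assumes "linearly_equivalent f g"
    and "a11 * (a22 * a33 - a23 * a32) - a12 * (a21 * a33 - a23 * a31)
             + a13 * (a21 * a32 - a22 * a31) \<noteq> 0"
  obtains h where "linearly_equivalent f h"
    and "\<And>x y z. h (vector [x, y, z]) = g (vector [a11 * x + a12 * y + a13 * z,
           a21 * x + a22 * y + a23 * z, a31 * x + a32 * y + a33 * z])"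
proof -
  define A :: "complex^3^3" where
    "A = vector [vector [a11, a12, a13], vector [a21, a22, a23], vector [a31, a32, a33]]"
  have "det A \<noteq> 0"
    using assms(2) by (simp add: A_def det_3 algebra_simps)
  then have "linearly_equivalent g (\<lambda>v. g (A *v v))"
    unfolding linearly_equivalent_def by (intro exI[of _ A]) (simp add: invertible_det_nz)
  then have "linearly_equivalent f (\<lambda>v. g (A *v v))"
    using assms(1) linearly_equivalent_trans by blast
  moreover have "g (A *v vector [x, y, z]) = g (vector [a11 * x + a12 * y + a13 * z,
      a21 * x + a22 * y + a23 * z, a31 * x + a32 * y + a33 * z])" for x y z
    by (intro arg_cong[where f = g]) (simp add: vec_eq_iff forall_3 A_def matrix_vector_mult_def sum_3)
  ultimately show thesis
    by (rule that)
qed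

lemma nonsingular_cone_linearly_equivalent:
  assumes "linearly_equivalent f g" "nonsingular_cone f"
  shows "nonsingular_cone g"
proof -
  obtain A B :: "complex^3^3" where AB: "A ** B = mat 1" "B ** A = mat 1"
    and g: "\<And>x. g x = f (A *v x)"
    using assms(1) by (auto simp: linearly_equivalent_def invertible_def)
  show ?thesis
    unfolding nonsingular_cone_def
  proof (intro allI impI)
    fix x assume x: "x \<noteq> 0" "g x = 0"
    have "A *v x \<noteq> 0"
      using x(1) AB(2) by (metis matrix_vector_mul_assoc matrix_vector_mul_lid matrix_vector_mult_0_right)
    then obtain w where w: "\<not> ((\<lambda>h. f (A *v x + h *s w)) has_field_derivative 0) (at 0)"
      using assms(2) x(2) g unfolding nonsingular_cone_def by metis
    have "A *v (x + h *s (B *v w)) = A *v x + h *s w" for h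
      by (simp add: matrix_vector_right_distrib vector_scalar_commute[symmetric]
          matrix_vector_mul_assoc AB)
    then show "\<exists>w. \<not> ((\<lambda>h. g (x + h *s w)) has_field_derivative 0) (at 0)"
      using w by (intro exI[of _ "B *v w"]) (simp add: g)
  qed
qed

text \<open>For polynomials, a zero is critical in the direction \<open>w\<close> when the restriction to the line through
  it is divisible by \<open>h\<^sup>2\<close>. A cubic leaves a quotient of degree at most one.\<close>

lemma nonsingular_coneD:
  assumes "nonsingular_cone f" "x \<noteq> 0" "f x = 0"
    and "\<And>w. \<exists>k0 k1. \<forall>h. f (x + h *s w) = h\<^sup>2 * (k0 + k1 * h)"
  shows False
proof -
  have "((\<lambda>h. f (x + h *s w)) has_field_derivative 0) (at 0)" for w
  proof -
    obtain k0 k1 where "\<And>h. f (x + h *s w) = h\<^sup>2 * (k0 + k1 * h)"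
      using assms(4) by blast
    then show ?thesis
      by (auto intro!: derivative_eq_intros)
  qed
  then show False
    using assms(1-3) unfolding nonsingular_cone_def by blast
qed

lemma cubic_form_zero: "cubic_form (\<lambda>x. 0)"
  unfolding cubic_form_def by (intro exI[of _ "\<lambda>i j k. 0"]) simp

lemma cubic_form_add:
  assumes "cubic_form f" "cubic_form g"
  shows "cubic_form (\<lambda>x. f x + g x)"
proof -
  obtain s t where "\<And>x. f x = (\<Sum>i\<in>UNIV. \<Sum>j\<in>UNIV. \<Sum>k\<in>UNIV. s i j k * (x $ i * x $ j * x $ k))"
    "\<And>x. g x = (\<Sum>i\<in>UNIV. \<Sum>j\<in>UNIV. \<Sum>k\<in>UNIV. t i j k * (x $ i * x $ j * x $ k))"
    using assms unfolding cubic_form_def by blast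
  then show ?thesis
    unfolding cubic_form_def
    by (intro exI[of _ "\<lambda>i j k. s i j k + t i j k"]) (simp add: distrib_right sum.distrib)
qed

lemma cubic_form_sum: "(\<And>m. m \<in> M \<Longrightarrow> cubic_form (f m)) \<Longrightarrow> cubic_form (\<lambda>x. \<Sum>m\<in>M. f m x)"
  by (induction M rule: infinite_finite_induct) (simp_all add: cubic_form_zero cubic_form_add)

lemma cubic_form_cmult:
  assumes "cubic_form f"
  shows "cubic_form (\<lambda>x. c * f x)"
proof -
  obtain t where "\<And>x. f x = (\<Sum>i\<in>UNIV. \<Sum>j\<in>UNIV. \<Sum>k\<in>UNIV. t i j k * (x $ i * x $ j * x $ k))"
    using assms unfolding cubic_form_def by blast
  then show ?thesis
    unfolding cubic_form_def
    by (intro exI[of _ "\<lambda>i j k. c * t i j k"]) (simp add: sum_distrib_left mult.assoc)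
qed

lemma cubic_form_linear_product:
  "cubic_form (\<lambda>x. (\<Sum>i\<in>UNIV. p i * x $ i) * (\<Sum>i\<in>UNIV. q i * x $ i) * (\<Sum>i\<in>UNIV. r i * x $ i))"
  unfolding cubic_form_def
  by (intro exI[of _ "\<lambda>i j k. p i * q j * r k"])
     (simp add: sum_3 algebra_simps)

lemma cubic_form_coordinate_product: "cubic_form (\<lambda>x. x $ i * x $ j * x $ k)"
proof -
  have coord: "(\<Sum>l\<in>UNIV. (if l = i then 1 else 0) * x $ l) = x $ i" for i and x :: "complex^3"
    by (simp add: if_distrib[of "\<lambda>u. u * _"] cong: if_cong)
  show ?thesis
    using cubic_form_linear_product[of "\<lambda>l. if l = i then 1 else 0"
        "\<lambda>l. if l = j then 1 else 0" "\<lambda>l. if l = k then 1 else 0"]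
    by (simp only: coord)
qed

lemma cubic_form_linearly_equivalent:
  assumes "linearly_equivalent f g" "cubic_form f"
  shows "cubic_form g"
proof -
  obtain A :: "complex^3^3" where g: "\<And>x. g x = f (A *v x)"
    using assms(1) by (auto simp: linearly_equivalent_def)
  obtain t where "\<And>x. f x = (\<Sum>i\<in>UNIV. \<Sum>j\<in>UNIV. \<Sum>k\<in>UNIV. t i j k * (x $ i * x $ j * x $ k))"
    using assms(2) unfolding cubic_form_def by blast
  then have "g = (\<lambda>x. \<Sum>i\<in>UNIV. \<Sum>j\<in>UNIV. \<Sum>k\<in>UNIV. t i j k *
      ((\<Sum>l\<in>UNIV. A $ i $ l * x $ l) * (\<Sum>l\<in>UNIV. A $ j $ l * x $ l) * (\<Sum>l\<in>UNIV. A $ k $ l * x $ l)))"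
    by (intro ext) (simp add: g matrix_vector_mult_def)
  then show ?thesis
    by (simp only: cubic_form_sum cubic_form_cmult cubic_form_linear_product)
qed

lemma cubic_form_coefficients:
  assumes "cubic_form f"
  obtains c300 c210 c201 c120 c111 c102 c030 c021 c012 c003 where
    "\<And>x y z. f (vector [x, y, z]) = c300 * x^3 + c210 * x\<^sup>2 * y + c201 * x\<^sup>2 * z + c120 * x * y\<^sup>2
       + c111 * x * y * z + c102 * x * z\<^sup>2 + c030 * y^3 + c021 * y\<^sup>2 * z + c012 * y * z\<^sup>2 + c003 * z^3"
proof -
  obtain t where t: "\<And>x. f x = (\<Sum>i\<in>UNIV. \<Sum>j\<in>UNIV. \<Sum>k\<in>UNIV. t i j k * (x $ i * x $ j * x $ k))"
    using assms unfolding cubic_form_def by blast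
  show thesis
    by (rule that[of "t 1 1 1" "t 1 1 2 + t 1 2 1 + t 2 1 1" "t 1 1 3 + t 1 3 1 + t 3 1 1"
          "t 1 2 2 + t 2 1 2 + t 2 2 1" "t 1 2 3 + t 1 3 2 + t 2 1 3 + t 2 3 1 + t 3 1 2 + t 3 2 1"
          "t 1 3 3 + t 3 1 3 + t 3 3 1" "t 2 2 2" "t 2 2 3 + t 2 3 2 + t 3 2 2"
          "t 2 3 3 + t 3 2 3 + t 3 3 2" "t 3 3 3"])
       (simp add: t sum_3 algebra_simps power2_eq_square power3_eq_cube)
qed

text \<open>Splitting off one coordinate at a time turns a monomial of degree three into a product of three
  coordinates without enumerating exponent vectors.\<close>

lemma monomial_split_coordinate:
  fixes m :: "'n::finite \<Rightarrow> nat"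
  assumes "sum m UNIV = Suc d"
  obtains i m' where "sum m' UNIV = d"
    and "\<And>x :: complex^'n. (\<Prod>l\<in>UNIV. x $ l ^ m l) = x $ i * (\<Prod>l\<in>UNIV. x $ l ^ m' l)"
proof -
  obtain i where i: "m i \<noteq> 0"
    using assms by (metis nat.distinct(1) sum.neutral)
  define m' where "m' = m(i := m i - 1)"
  have rest: "m' l = m l" if "l \<in> UNIV - {i}" for l
    using that by (simp add: m'_def)
  have "sum m' (UNIV - {i}) = sum m (UNIV - {i})"
    using rest by (rule sum.cong[OF refl])
  then have "sum m' UNIV = d"
    using assms i by (simp add: sum.remove[of UNIV i] m'_def)
  moreover have "(\<Prod>l\<in>UNIV. x $ l ^ m l) = x $ i * (\<Prod>l\<in>UNIV. x $ l ^ m' l)" for x :: "complex^'n"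
  proof -
    have "(\<Prod>l\<in>UNIV - {i}. x $ l ^ m' l) = (\<Prod>l\<in>UNIV - {i}. x $ l ^ m l)"
      using rest by (intro prod.cong) simp_all
    moreover have "x $ i ^ m i = x $ i * x $ i ^ m' i"
      using i by (simp add: m'_def power_eq_if)
    ultimately show ?thesis
      by (simp add: prod.remove[of UNIV i])
  qed
  ultimately show thesis
    by (rule that)
qed

lemma cubic_form_form_eval: "cubic_form (form_eval 3 a)"
proof -
  have mono: "\<exists>i j k. \<forall>x::complex^3. (\<Prod>i\<in>UNIV. x $ i ^ m i) = x $ i * x $ j * x $ k"
    if "m \<in> exponents 3" for m :: "3 \<Rightarrow> nat"
  proof -
    have "sum m UNIV = Suc 2"
      using that by (simp add: exponents_def)
    then obtain i m1 where 1: "sum m1 UNIV = Suc 1"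
      "\<And>x :: complex^3. (\<Prod>l\<in>UNIV. x $ l ^ m l) = x $ i * (\<Prod>l\<in>UNIV. x $ l ^ m1 l)"
      by (metis monomial_split_coordinate Suc_1)
    then obtain j m2 where 2: "sum m2 UNIV = Suc 0"
      "\<And>x :: complex^3. (\<Prod>l\<in>UNIV. x $ l ^ m1 l) = x $ j * (\<Prod>l\<in>UNIV. x $ l ^ m2 l)"
      by (metis monomial_split_coordinate One_nat_def)
    then obtain k m3 where 3: "sum m3 UNIV = 0"
      "\<And>x :: complex^3. (\<Prod>l\<in>UNIV. x $ l ^ m2 l) = x $ k * (\<Prod>l\<in>UNIV. x $ l ^ m3 l)"
      by (metis monomial_split_coordinate)
    from 3(1) have "m3 l = 0" for l
      by simp
    then show ?thesis
      using 1(2) 2(2) 3(2) by (intro exI[of _ i] exI[of _ j] exI[of _ k]) (simp add: mult.assoc)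
  qed
  show ?thesis
    unfolding form_eval_def
  proof (intro cubic_form_sum cubic_form_cmult)
    fix m :: "3 \<Rightarrow> nat" assume "m \<in> exponents 3"
    then obtain i j k where "\<And>x::complex^3. (\<Prod>i\<in>UNIV. x $ i ^ m i) = x $ i * x $ j * x $ k"
      using mono by blast
    then show "cubic_form (\<lambda>x. \<Prod>i\<in>UNIV. x $ i ^ m i)"
      by (simp add: cubic_form_coordinate_product)
  qed
qed

lemma has_field_derivative_form_eval:
  "((\<lambda>h. form_eval d a (x + h *s axis k 1)) has_field_derivative form_partial d a k x) (at 0)"
proof -
  have "form_eval d a (x + h *s axis k 1)
      = (\<Sum>m\<in>exponents d. a m * ((x $ k + h) ^ m k * (\<Prod>i\<in>UNIV - {k}. x $ i ^ m i)))" for h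
    unfolding form_eval_def
  proof (intro sum.cong refl arg_cong2[where f = "(*)"])
    fix m :: "3 \<Rightarrow> nat"
    have "(\<Prod>i\<in>UNIV. (x + h *s axis k 1) $ i ^ m i)
        = (x + h *s axis k 1) $ k ^ m k * (\<Prod>i\<in>UNIV - {k}. (x + h *s axis k 1) $ i ^ m i)"
      by (rule prod.remove) simp_all
    also have "(\<Prod>i\<in>UNIV - {k}. (x + h *s axis k 1) $ i ^ m i) = (\<Prod>i\<in>UNIV - {k}. x $ i ^ m i)"
      by (intro prod.cong) (auto simp: axis_def)
    finally show "(\<Prod>i\<in>UNIV. (x + h *s axis k 1) $ i ^ m i)
        = (x $ k + h) ^ m k * (\<Prod>i\<in>UNIV - {k}. x $ i ^ m i)"
      by (simp add: axis_def)
  qed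
  then show ?thesis
    unfolding form_partial_def
    by (auto intro!: derivative_eq_intros sum.cong)
qed

lemma nonsingular_cone_form_eval:
  assumes "nonsingular_form d a"
  shows "nonsingular_cone (form_eval d a)"
  using assms has_field_derivative_form_eval DERIV_unique
  unfolding nonsingular_form_def nonsingular_cone_def by metis

section \<open>Weierstrass form of a nonsingular cubic\<close>

lemma nonsingular_cone_vectorD:
  assumes "nonsingular_cone f" "(x, y, z) \<noteq> (0, 0, 0)" "f (vector [x, y, z]) = 0"
    and "\<And>p q r. \<exists>k0 k1. \<forall>h. f (vector [x + h * p, y + h * q, z + h * r]) = h\<^sup>2 * (k0 + k1 * h)"
  shows False
proof (rule nonsingular_coneD[OF assms(1) _ assms(3)])
  show "vector [x, y, z] \<noteq> (0 :: complex^3)"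
    using assms(2) by (simp add: vec_eq_iff forall_3)
  fix w :: "complex^3"
  have "vector [x, y, z] + h *s w = vector [x + h * w $ 1, y + h * w $ 2, z + h * w $ 3]" for h
    by (simp add: vec_eq_iff forall_3)
  then show "\<exists>k0 k1. \<forall>h. f (vector [x, y, z] + h *s w) = h\<^sup>2 * (k0 + k1 * h)"
    using assms(4) by simp
qed

text \<open>A line always meets the curve: its equation restricted to \<open>z = 0\<close> is a binary cubic, which has a
  root.\<close>

lemma cubic_has_zero_normalized:
  assumes "cubic_form f"
  obtains g where "linearly_equivalent f g" "g (vector [1, 0, 0]) = 0"
proof -
  obtain c300 c210 c201 c120 c111 c102 c030 c021 c012 c003 where
    f: "\<And>x y z. f (vector [x, y, z]) = c300 * x^3 + c210 * x\<^sup>2 * y + c201 * x\<^sup>2 * z + c120 * x * y\<^sup>2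
       + c111 * x * y * z + c102 * x * z\<^sup>2 + c030 * y^3 + c021 * y\<^sup>2 * z + c012 * y * z\<^sup>2 + c003 * z^3"
    using cubic_form_coefficients[OF assms] by blast
  show thesis
  proof (cases "c300 = 0")
    case True
    then have "f (vector [1, 0, 0]) = 0"
      by (simp add: f)
    with linearly_equivalent_refl show ?thesis
      by (rule that)
  next
    case False
    define P where "P = [:c030, c120, c210, c300:]"
    have "\<not> constant (poly P)"
      using False by (simp add: constant_degree P_def)
    then obtain h where h: "poly P h = 0"
      using fundamental_theorem_of_algebra by blast
    have zero: "f (vector [h, 1, 0]) = 0"
      using h by (simp add: f P_def algebra_simps power2_eq_square power3_eq_cube)
    obtain g where g: "linearly_equivalent f g"
      "\<And>x y z. g (vector [x, y, z])
         = f (vector [h * x + 1 * y + 0 * z, 1 * x + 0 * y + 0 * z, 0 * x + 0 * y + 1 * z])"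
      by (rule linear_substitution[OF linearly_equivalent_refl[of f], where ?a11.0 = h and ?a12.0 = 1 and ?a13.0 = 0
            and ?a21.0 = 1 and ?a22.0 = 0 and ?a23.0 = 0 and ?a31.0 = 0 and ?a32.0 = 0 and ?a33.0 = 1])
        simp_all
    then show ?thesis
      using zero by (intro that[of g]) simp_all
  qed
qed

text \<open>The point \<open>(1, 0, 0)\<close> of the curve is nonsingular, so its tangent line is well defined and can be
  taken to be \<open>z = 0\<close>. The restriction to this line has a double zero there, which leaves
  \<open>y\<^sup>2 (c x + D y)\<close>. The point is a flex exactly when \<open>c = 0\<close>.\<close>

lemma cubic_tangent_normal_form:
  assumes "cubic_form f" "nonsingular_cone f"
  obtains g c D B C E F G where "linearly_equivalent f g"
    "\<And>x y z. g (vector [x, y, z]) = c * x * y\<^sup>2 + D * y^3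
       + z * (x\<^sup>2 + B * x * y + C * x * z + E * y\<^sup>2 + F * y * z + G * z\<^sup>2)"
proof -
  obtain g where g: "linearly_equivalent f g" "g (vector [1, 0, 0]) = 0"
    using cubic_has_zero_normalized[OF assms(1)] by blast
  obtain c300 c210 c201 c120 c111 c102 c030 c021 c012 c003 where
    gc: "\<And>x y z. g (vector [x, y, z]) = c300 * x^3 + c210 * x\<^sup>2 * y + c201 * x\<^sup>2 * z + c120 * x * y\<^sup>2
       + c111 * x * y * z + c102 * x * z\<^sup>2 + c030 * y^3 + c021 * y\<^sup>2 * z + c012 * y * z\<^sup>2 + c003 * z^3"
    using cubic_form_coefficients[OF cubic_form_linearly_equivalent[OF g(1) assms(1)]] by blast
  have c300: "c300 = 0"
    using g(2) by (simp add: gc)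
  have tangent: "c210 \<noteq> 0 \<or> c201 \<noteq> 0"
  proof (rule ccontr)
    assume "\<not> ?thesis"
    then have 0: "c210 = 0" "c201 = 0" by auto
    show False
    proof (rule nonsingular_cone_vectorD[of g 1 0 0])
      show "nonsingular_cone g"
        using nonsingular_cone_linearly_equivalent g(1) assms(2) .
      fix p q r
      show "\<exists>k0 k1. \<forall>h. g (vector [1 + h * p, 0 + h * q, 0 + h * r]) = h\<^sup>2 * (k0 + k1 * h)"
        by (intro exI[of _ "c120 * q\<^sup>2 + c111 * q * r + c102 * r\<^sup>2"]
            exI[of _ "c120 * p * q\<^sup>2 + c111 * p * q * r + c102 * p * r\<^sup>2 + c030 * q^3
              + c021 * q\<^sup>2 * r + c012 * q * r\<^sup>2 + c003 * r^3"])
          (simp add: gc c300 0 algebra_simps power2_eq_square power3_eq_cube)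
    qed (simp_all add: g(2))
  qed
  show thesis
  proof (cases "c201 = 0")
    case False
    define m k where "m = 1 / c201" and "k = - c210 / c201"
    then have mk: "c201 * m = 1" "c210 + c201 * k = 0" "m \<noteq> 0"
      using False by simp_all
    obtain h where h: "linearly_equivalent f h"
      "\<And>x y z. h (vector [x, y, z])
         = g (vector [1 * x + 0 * y + 0 * z, 0 * x + 1 * y + 0 * z, 0 * x + k * y + m * z])"
      by (rule linear_substitution[OF g(1), where ?a11.0 = 1 and ?a12.0 = 0 and ?a13.0 = 0
            and ?a21.0 = 0 and ?a22.0 = 1 and ?a23.0 = 0 and ?a31.0 = 0 and ?a32.0 = k and ?a33.0 = m])
        (simp_all add: mk(3))
    have "h (vector [x, y, z])
        = (c120 + c111 * k + c102 * k\<^sup>2) * x * y\<^sup>2 + (c030 + c021 * k + c012 * k\<^sup>2 + c003 * k^3) * y^3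
       + z * (x\<^sup>2 + (c111 * m + 2 * c102 * k * m) * x * y + (c102 * m\<^sup>2) * x * z
         + (c021 * m + 2 * c012 * k * m + 3 * c003 * k\<^sup>2 * m) * y\<^sup>2
         + (c012 * m\<^sup>2 + 3 * c003 * k * m\<^sup>2) * y * z + (c003 * m^3) * z\<^sup>2)" for x y z
      unfolding h(2) gc c300 using mk by algebra
    with h(1) show thesis
      by (rule that)
  next
    case True
    define m where "m = 1 / c210"
    then have m: "c210 * m = 1" "m \<noteq> 0"
      using True tangent by simp_all
    obtain h where h: "linearly_equivalent f h"
      "\<And>x y z. h (vector [x, y, z])
         = g (vector [1 * x + 0 * y + 0 * z, 0 * x + 0 * y + m * z, 0 * x + 1 * y + 0 * z])"
      by (rule linear_substitution[OF g(1), where ?a11.0 = 1 and ?a12.0 = 0 and ?a13.0 = 0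
            and ?a21.0 = 0 and ?a22.0 = 0 and ?a23.0 = m and ?a31.0 = 0 and ?a32.0 = 1 and ?a33.0 = 0])
        (simp_all add: m(2))
    have "h (vector [x, y, z]) = c102 * x * y\<^sup>2 + c003 * y^3
       + z * (x\<^sup>2 + (c111 * m) * x * y + (c120 * m\<^sup>2) * x * z
         + (c012 * m) * y\<^sup>2 + (c021 * m\<^sup>2) * y * z + (c030 * m^3) * z\<^sup>2)" for x y z
      unfolding h(2) gc c300 True using m by algebra
    with h(1) show thesis
      by (rule that)
  qed
qed

text \<open>If the point is not a flex, its tangent line meets the curve in one further point. This point is
  moved to \<open>(0, 1, 0)\<close>; the terms \<open>y\<^sup>2 z\<close> and \<open>x y z\<close> are then absorbed into \<open>x y\<^sup>2\<close>.\<close>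

lemma cubic_nonflex_normal_form:
  assumes "linearly_equivalent f g" "c \<noteq> 0"
    and g: "\<And>x y z. g (vector [x, y, z]) = c * x * y\<^sup>2 + D * y^3
       + z * (x\<^sup>2 + B * x * y + C * x * z + E * y\<^sup>2 + F * y * z + G * z\<^sup>2)"
  obtains h C' E' G' where "linearly_equivalent f h"
    "\<And>x y z. h (vector [x, y, z]) = x * y\<^sup>2 + z * (x\<^sup>2 + C' * x * z + E' * y * z + G' * z\<^sup>2)"
proof -
  define m where "m = 1 / c"
  then have m: "m \<noteq> 0" "c * m = 1"
    using assms(2) by simp_all
  obtain g1 where g1: "linearly_equivalent f g1"
    "\<And>x y z. g1 (vector [x, y, z])
       = g (vector [m * x + (- (m * D)) * y + 0 * z, 0 * x + 1 * y + 0 * z, 0 * x + 0 * y + c\<^sup>2 * z])"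
    by (rule linear_substitution[OF assms(1), where ?a11.0 = m and ?a12.0 = "- (m * D)" and ?a13.0 = 0
          and ?a21.0 = 0 and ?a22.0 = 1 and ?a23.0 = 0 and ?a31.0 = 0 and ?a32.0 = 0 and ?a33.0 = "c\<^sup>2"])
      (simp_all add: m assms(2))
  define B1 C1 E1 F1 G1 where "B1 = c\<^sup>2 * (B * m - 2 * m\<^sup>2 * D)" and "C1 = c^4 * C * m"
    and "E1 = c\<^sup>2 * (m\<^sup>2 * D\<^sup>2 - B * m * D + E)" and "F1 = c^4 * (F - C * m * D)" and "G1 = c^6 * G"
  have g1': "g1 (vector [x, y, z]) = x * y\<^sup>2
      + z * (x\<^sup>2 + B1 * x * y + C1 * x * z + E1 * y\<^sup>2 + F1 * y * z + G1 * z\<^sup>2)" for x y z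
    unfolding g1(2) g B1_def C1_def E1_def F1_def G1_def using m(2) by algebra
  obtain g2 where g2: "linearly_equivalent f g2"
    "\<And>x y z. g2 (vector [x, y, z])
       = g1 (vector [1 * x + 0 * y + (- E1) * z, 0 * x + 1 * y + (- B1 / 2) * z, 0 * x + 0 * y + 1 * z])"
    by (rule linear_substitution[OF g1(1), where ?a11.0 = 1 and ?a12.0 = 0 and ?a13.0 = "- E1"
          and ?a21.0 = 0 and ?a22.0 = 1 and ?a23.0 = "- B1 / 2" and ?a31.0 = 0 and ?a32.0 = 0 and ?a33.0 = 1])
      simp_all
  define b where "b = B1 / 2"
  have "g2 (vector [x, y, z]) = x * y\<^sup>2 + z * (x\<^sup>2
      + (C1 - 2 * E1 - b\<^sup>2) * x * z + (F1 - 2 * b * E1) * y * z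
      + (G1 - F1 * b + 2 * b\<^sup>2 * E1 + E1\<^sup>2 - C1 * E1) * z\<^sup>2)" for x y z
  proof -
    have B1: "B1 = 2 * b" by (simp add: b_def)
    have "g2 (vector [x, y, z]) = g1 (vector [x - E1 * z, y - b * z, z])"
      by (simp add: g2(2) b_def)
    then show ?thesis
      unfolding g1' B1 by algebra
  qed
  with g2(1) show thesis
    by (rule that)
qed

text \<open>The three equations say that on the line \<open>x = \<mu> y + \<nu> z\<close> the cubic
  \<open>x y\<^sup>2 + z (x\<^sup>2 + C x z + E y z + G z\<^sup>2)\<close> becomes the cube \<open>\<mu> (y + \<rho> z)\<^sup>3\<close>, which makes the line a
  tangent at a flex. Put \<open>w = \<mu> \<rho>\<close>; the first equation gives \<open>\<nu> = 3 w - \<mu>\<^sup>2\<close>. The second one, times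
  \<open>\<mu>\<close>, becomes the quadratic equation \<open>3 w\<^sup>2 - 6 \<mu>\<^sup>2 w + \<mu> d = 0\<close>, and the third one, times \<open>\<mu>\<^sup>2\<close>,
  reduces modulo this quadratic to a linear equation, which after division by \<open>\<mu> / 3\<close> reads
  \<open>u w + \<mu> e = 0\<close>. The resultant of the two is \<open>\<mu> R\<close>, where \<open>R = 3 \<mu> e\<^sup>2 + 6 \<mu>\<^sup>2 u e + d u\<^sup>2\<close> is a polynomial
  in \<open>\<mu>\<close> of degree nine. It remains to find a nonzero root of \<open>R\<close>.\<close>

lemma flex_line_parameters:
  fixes C E G :: complex
  assumes "(E, G) \<noteq> (0, 0)"
  obtains \<mu> \<nu> \<rho> where "\<mu> \<noteq> 0" "\<nu> + \<mu>\<^sup>2 = 3 * \<mu> * \<rho>" "2 * \<mu> * \<nu> + C * \<mu> + E = 3 * \<mu> * \<rho>\<^sup>2"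
    "\<nu>\<^sup>2 + C * \<nu> + G = \<mu> * \<rho>^3"
proof -
  define u e d where "u x = 26 * x^3 + 8 * C * x - E"
    and "e x = - 11 * x^4 + 4 * C * x\<^sup>2 + 7 * E * x + 3 * G"
    and "d x = 2 * x^3 - C * x - E" for x
  have "\<exists>\<mu>. \<mu> \<noteq> 0 \<and> 3 * \<mu> * (e \<mu>)\<^sup>2 + 6 * \<mu>\<^sup>2 * u \<mu> * e \<mu> + d \<mu> * (u \<mu>)\<^sup>2 = 0"
  \<comment> \<open>The constant term of \<open>R\<close> is \<open>- E\<^sup>3\<close>. If \<open>E = 0\<close>, then \<open>R / \<mu>\<close> has degree eight and constant
    term \<open>27 G\<^sup>2\<close>.\<close>
  proof (cases "E = 0")
    case False
    define U P D X where "U = [:-E, 8 * C, 0, 26:]" and "P = [:3 * G, 7 * E, 4 * C, 0, -11:]"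
      and "D = [:-E, -C, 0, 2:]" and "X = [:0, 1 :: complex:]"
    define R where "R = 3 * X * P\<^sup>2 + 6 * X\<^sup>2 * U * P + D * U\<^sup>2"
    have R: "poly R x = 3 * x * (e x)\<^sup>2 + 6 * x\<^sup>2 * u x * e x + d x * (u x)\<^sup>2" for x
    proof -
      have "poly U x = u x" "poly P x = e x" "poly D x = d x" "poly X x = x"
        by (simp_all add: U_def P_def D_def X_def u_def e_def d_def algebra_simps power2_eq_square
            power3_eq_cube power4_eq_xxxx)
      then show ?thesis by (simp add: R_def)
    qed
    have "coeff R 9 = -1"
      by (simp add: R_def U_def P_def D_def X_def power2_eq_square numeral_poly eval_nat_numeral)
    then have "\<not> constant (poly R)"
      using le_degree[of R 9] by (simp add: constant_degree)
    then obtain \<mu> where \<mu>: "poly R \<mu> = 0"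
      using fundamental_theorem_of_algebra by blast
    moreover have "poly R 0 \<noteq> 0"
      using False by (simp add: R d_def u_def)
    ultimately show ?thesis
      using R by metis
  next
    case True
    then have G: "G \<noteq> 0" using assms by simp
    define U P D X where "U = [:8 * C, 0, 26:]" and "P = [:3 * G, 0, 4 * C, 0, -11:]"
      and "D = [:-C, 0, 2:]" and "X = [:0, 1 :: complex:]"
    define R where "R = 3 * P\<^sup>2 + 6 * X\<^sup>2 * U * P + X\<^sup>2 * D * U\<^sup>2"
    have R: "x * poly R x = 3 * x * (e x)\<^sup>2 + 6 * x\<^sup>2 * u x * e x + d x * (u x)\<^sup>2" for x
    proof -
      have "x * poly U x = u x" "poly P x = e x" "x * poly D x = d x" "poly X x = x"
        by (simp_all add: U_def P_def D_def X_def u_def e_def d_def True algebra_simps power2_eq_square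
            power3_eq_cube power4_eq_xxxx)
      moreover have "x * poly R x = 3 * x * (poly P x)\<^sup>2 + 6 * (poly X x)\<^sup>2 * (x * poly U x) * poly P x
          + (x * poly D x) * (x * poly U x)\<^sup>2"
        using \<open>poly X x = x\<close> by (simp add: R_def power2_eq_square algebra_simps)
      ultimately show ?thesis by simp
    qed
    have "coeff R 8 = -1"
      by (simp add: R_def U_def P_def D_def X_def power2_eq_square numeral_poly eval_nat_numeral)
    then have "\<not> constant (poly R)"
      using le_degree[of R 8] by (simp add: constant_degree)
    then obtain \<mu> where \<mu>: "poly R \<mu> = 0"
      using fundamental_theorem_of_algebra by blast
    moreover have "poly R 0 \<noteq> 0"
      using G by (simp add: R_def X_def P_def)
    ultimately show ?thesis
      using R by (metis mult_zero_right)
  qed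
  then obtain \<mu> where \<mu>: "\<mu> \<noteq> 0" "3 * \<mu> * (e \<mu>)\<^sup>2 + 6 * \<mu>\<^sup>2 * u \<mu> * e \<mu> + d \<mu> * (u \<mu>)\<^sup>2 = 0"
    by blast
  \<comment> \<open>If the linear equation degenerates, then \<open>R = 0\<close> forces it to be trivial and the quadratic alone
    determines \<open>w\<close>.\<close>
  have "\<exists>w. 3 * w\<^sup>2 - 6 * \<mu>\<^sup>2 * w + \<mu> * d \<mu> = 0 \<and> u \<mu> * w + \<mu> * e \<mu> = 0"
  proof (cases "u \<mu> = 0")
    case True
    then have "e \<mu> = 0"
      using \<mu> by simp
    define r where "r = csqrt (\<mu>^4 - \<mu> * d \<mu> / 3)"
    have "3 * r\<^sup>2 = 3 * \<mu>^4 - \<mu> * d \<mu>"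
      by (simp add: r_def algebra_simps)
    then have "3 * (\<mu>\<^sup>2 + r)\<^sup>2 - 6 * \<mu>\<^sup>2 * (\<mu>\<^sup>2 + r) + \<mu> * d \<mu> = 0"
      by algebra
    then show ?thesis
      using True \<open>e \<mu> = 0\<close> by (intro exI[of _ "\<mu>\<^sup>2 + r"]) simp
  next
    case False
    define w where "w = - \<mu> * e \<mu> / u \<mu>"
    then have w: "u \<mu> * w + \<mu> * e \<mu> = 0"
      using False by simp
    have "(u \<mu>)\<^sup>2 * (3 * w\<^sup>2 - 6 * \<mu>\<^sup>2 * w + \<mu> * d \<mu>) = 0"
      using w \<mu>(2) by algebra
    then show ?thesis
      using w False by auto
  qed
  then obtain w where w: "3 * w\<^sup>2 - 6 * \<mu>\<^sup>2 * w + \<mu> * d \<mu> = 0" "u \<mu> * w + \<mu> * e \<mu> = 0"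
    by blast
  define \<rho> \<nu> where "\<rho> = w / \<mu>" and "\<nu> = 3 * w - \<mu>\<^sup>2"
  have \<rho>: "\<mu> * \<rho> = w"
    using \<mu>(1) by (simp add: \<rho>_def)
  have "\<mu> * (2 * \<mu> * \<nu> + C * \<mu> + E) = \<mu> * (3 * \<mu> * \<rho>\<^sup>2)"
    using w(1) \<rho> unfolding \<nu>_def d_def by algebra
  moreover have "3 * (\<mu>\<^sup>2 * (\<nu>\<^sup>2 + C * \<nu> + G)) = 3 * (\<mu>\<^sup>2 * (\<mu> * \<rho>^3))"
  proof -
    have "3 * (\<mu>\<^sup>2 * (\<nu>\<^sup>2 + C * \<nu> + G)) = 3 * w^3"
      using w unfolding \<nu>_def d_def u_def e_def by algebra
    also have "w^3 = \<mu>\<^sup>2 * (\<mu> * \<rho>^3)"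
      by (simp add: \<rho>[symmetric] power_mult_distrib power2_eq_square power3_eq_cube)
    finally show ?thesis .
  qed
  ultimately have "2 * \<mu> * \<nu> + C * \<mu> + E = 3 * \<mu> * \<rho>\<^sup>2" "\<nu>\<^sup>2 + C * \<nu> + G = \<mu> * \<rho>^3"
    using \<mu>(1) by simp_all
  moreover have "\<nu> + \<mu>\<^sup>2 = 3 * \<mu> * \<rho>"
    using \<rho> by (simp add: \<nu>_def)
  ultimately show thesis
    using that \<mu>(1) by blast
qed

text \<open>Otherwise the point \<open>(0, t, 1)\<close> with \<open>t\<^sup>2 = - C\<close> is singular: there the factor \<open>x\<close> and the factor
  \<open>y\<^sup>2 + x z + C z\<^sup>2\<close> vanish together.\<close>

lemma nonsingular_nonflex_form:
  assumes "nonsingular_cone f"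
    and f: "\<And>x y z. f (vector [x, y, z]) = x * y\<^sup>2 + z * (x\<^sup>2 + C * x * z + E * y * z + G * z\<^sup>2)"
  shows "(E, G) \<noteq> (0, 0)"
proof
  assume "(E, G) = (0, 0)"
  then have 0: "E = 0" "G = 0" by simp_all
  define t where "t = csqrt (- C)"
  then have t: "t\<^sup>2 = - C" by simp
  show False
  proof (rule nonsingular_cone_vectorD[OF assms(1), of 0 t 1])
    fix p q r
    have "f (vector [0 + h * p, t + h * q, 1 + h * r])
        = h\<^sup>2 * (p * (2 * t * q + p + 2 * C * r) + p * (q\<^sup>2 + p * r + C * r\<^sup>2) * h)" for h
      unfolding f 0 using t by algebra
    then show "\<exists>k0 k1. \<forall>h. f (vector [0 + h * p, t + h * q, 1 + h * r]) = h\<^sup>2 * (k0 + k1 * h)"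
      by blast
  qed (simp_all add: f 0)
qed

text \<open>If \<open>A = 0\<close>, the point \<open>(1, 0, 0)\<close> is singular. If \<open>D = 0\<close>, the line \<open>z = 0\<close> is a component of the curve
  and is met by the residual conic, in a singular point.\<close>

lemma nonsingular_flex_form:
  assumes "nonsingular_cone f"
    and f: "\<And>x y z. f (vector [x, y, z]) = D * y^3
       + z * (A * x\<^sup>2 + B * x * y + C * x * z + E * y\<^sup>2 + F * y * z + G * z\<^sup>2)"
  shows "A \<noteq> 0" "D \<noteq> 0"
proof -
  show A: "A \<noteq> 0"
  proof
    assume 0: "A = 0"
    show False
    proof (rule nonsingular_cone_vectorD[OF assms(1), of 1 0 0])
      fix p q r
      have "f (vector [1 + h * p, 0 + h * q, 0 + h * r])
          = h\<^sup>2 * (r * (B * q + C * r) + (D * q^3 + r * (B * p * q + C * p * r + E * q\<^sup>2 + F * q * r + G * r\<^sup>2)) * h)"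
        for h
        unfolding f 0 by algebra
      then show "\<exists>k0 k1. \<forall>h. f (vector [1 + h * p, 0 + h * q, 0 + h * r]) = h\<^sup>2 * (k0 + k1 * h)"
        by blast
    qed (simp_all add: f)
  qed
  show "D \<noteq> 0"
  proof
    assume 0: "D = 0"
    have "\<not> constant (poly [:E, B, A:])"
      using A by (simp add: constant_degree)
    then obtain t where "poly [:E, B, A:] t = 0"
      using fundamental_theorem_of_algebra by blast
    then have t: "E + B * t + A * t\<^sup>2 = 0"
      by (simp add: algebra_simps power2_eq_square)
    show False
    proof (rule nonsingular_cone_vectorD[OF assms(1), of t 1 0])
      fix p q r
      have "f (vector [t + h * p, 1 + h * q, 0 + h * r])
          = h\<^sup>2 * (r * (2 * A * t * p + B * (p + q * t) + C * t * r + 2 * E * q + F * r)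
              + r * (A * p\<^sup>2 + B * p * q + C * p * r + E * q\<^sup>2 + F * q * r + G * r\<^sup>2) * h)" for h
        unfolding f 0 using t by algebra
      then show "\<exists>k0 k1. \<forall>h. f (vector [t + h * p, 1 + h * q, 0 + h * r]) = h\<^sup>2 * (k0 + k1 * h)"
        by blast
    qed (simp_all add: f 0)
  qed
qed

text \<open>A nonsingular cubic has a flex: the point found first may be one, and otherwise a line tangent at
  a flex is solved for. The flex is \<open>(1, 0, 0)\<close> and its tangent line is \<open>z = 0\<close>.\<close>

lemma cubic_flex_normal_form:
  assumes "cubic_form f" "nonsingular_cone f"
  obtains g D A B C E F G where "linearly_equivalent f g"
    "\<And>x y z. g (vector [x, y, z]) = D * y^3
       + z * (A * x\<^sup>2 + B * x * y + C * x * z + E * y\<^sup>2 + F * y * z + G * z\<^sup>2)"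
proof -
  obtain g c D B C E F G where g: "linearly_equivalent f g"
    "\<And>x y z. g (vector [x, y, z]) = c * x * y\<^sup>2 + D * y^3
       + z * (x\<^sup>2 + B * x * y + C * x * z + E * y\<^sup>2 + F * y * z + G * z\<^sup>2)"
    by (rule cubic_tangent_normal_form[OF assms]) (rule that; assumption)
  show thesis
  proof (cases "c = 0")
    case True
    then show ?thesis
      using that[of g D 1 B C E F G] g by simp
  next
    case False
    obtain h C E G where h: "linearly_equivalent f h"
      "\<And>x y z. h (vector [x, y, z]) = x * y\<^sup>2 + z * (x\<^sup>2 + C * x * z + E * y * z + G * z\<^sup>2)"
      by (rule cubic_nonflex_normal_form[OF g(1) False g(2)]) (rule that; assumption)
    have "(E, G) \<noteq> (0, 0)"
      by (rule nonsingular_nonflex_form[OF nonsingular_cone_linearly_equivalent[OF h(1) assms(2)] h(2)])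
    then obtain \<mu> \<nu> \<rho> where \<mu>: "\<mu> \<noteq> 0" and line: "\<nu> + \<mu>\<^sup>2 = 3 * \<mu> * \<rho>"
      "2 * \<mu> * \<nu> + C * \<mu> + E = 3 * \<mu> * \<rho>\<^sup>2" "\<nu>\<^sup>2 + C * \<nu> + G = \<mu> * \<rho>^3"
      by (rule flex_line_parameters)
    \<comment> \<open>The first column is the flex, where \<open>y + \<rho> z\<close> vanishes; the second is another point of the line.\<close>
    obtain k where k: "linearly_equivalent f k"
      "\<And>x y z. k (vector [x, y, z])
         = h (vector [(\<nu> - \<mu> * \<rho>) * x + \<mu> * y + 1 * z, (- \<rho>) * x + 1 * y + 0 * z, 1 * x + 0 * y + 0 * z])"
      by (rule linear_substitution[OF h(1), where ?a11.0 = "\<nu> - \<mu> * \<rho>" and ?a12.0 = \<mu> and ?a13.0 = 1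
            and ?a21.0 = "- \<rho>" and ?a22.0 = 1 and ?a23.0 = 0 and ?a31.0 = 1 and ?a32.0 = 0 and ?a33.0 = 0])
        simp_all
    have EG: "E = 3 * \<mu> * \<rho>\<^sup>2 - 2 * \<mu> * \<nu> - C * \<mu>" "G = \<mu> * \<rho>^3 - \<nu>\<^sup>2 - C * \<nu>"
      using line by algebra+
    have "k (vector [x, y, z]) = \<mu> * y^3
       + z * ((\<rho>\<^sup>2 + 2 * (\<nu> - \<mu> * \<rho>) + C) * x\<^sup>2 + (2 * \<mu> - 2 * \<rho>) * x * y + 1 * x * z + 1 * y\<^sup>2
         + 0 * y * z + 0 * z\<^sup>2)" for x y z
      unfolding k(2) h(2) EG using line(1) by algebra
    with k(1) show ?thesis
      by (rule that)
  qed
qed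

text \<open>The coefficients of \<open>y\<^sup>3\<close> and \<open>x\<^sup>2 z\<close> are scaled to \<open>1\<close> and \<open>- 1\<close>, then the square in \<open>x\<close> and the
  cube in \<open>y\<close> are completed.\<close>

lemma nonsingular_cubic_weierstrass_form:
  assumes "cubic_form f" "nonsingular_cone f"
  obtains g a b where "linearly_equivalent f g"
    "\<And>x y z. g (vector [x, y, z]) = y^3 - x\<^sup>2 * z + a * y * z\<^sup>2 + b * z^3"
proof -
  obtain g D A B C E F G where g: "linearly_equivalent f g"
    "\<And>x y z. g (vector [x, y, z]) = D * y^3
       + z * (A * x\<^sup>2 + B * x * y + C * x * z + E * y\<^sup>2 + F * y * z + G * z\<^sup>2)"
    by (rule cubic_flex_normal_form[OF assms]) (rule that; assumption)
  have "nonsingular_cone g"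
    using nonsingular_cone_linearly_equivalent g(1) assms(2) .
  then have AD: "A \<noteq> 0" "D \<noteq> 0"
    using nonsingular_flex_form[OF _ g(2)] by simp_all
  have "\<not> constant (poly [:- 1, 0, 0, D:])"
    using AD(2) by (simp add: constant_degree)
  then obtain m where "poly [:- 1, 0, 0, D:] m = 0"
    using fundamental_theorem_of_algebra by blast
  then have m: "D * m^3 = 1"
    by (simp add: algebra_simps power3_eq_cube)
  define n where "n = csqrt (- 1 / A)"
  then have n: "A * n\<^sup>2 = - 1"
    using AD(1) by simp
  have "m \<noteq> 0" "n \<noteq> 0"
    using m n by auto
  then obtain g1 where g1: "linearly_equivalent f g1"
    "\<And>x y z. g1 (vector [x, y, z])
       = g (vector [n * x + 0 * y + 0 * z, 0 * x + m * y + 0 * z, 0 * x + 0 * y + 1 * z])"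
    by (rule_tac linear_substitution[OF g(1), where ?a11.0 = n and ?a12.0 = 0 and ?a13.0 = 0
          and ?a21.0 = 0 and ?a22.0 = m and ?a23.0 = 0 and ?a31.0 = 0 and ?a32.0 = 0 and ?a33.0 = 1])
      simp_all
  define p q where "p = B * n * m / 2" and "q = C * n / 2"
  have g1': "g1 (vector [x, y, z]) = y^3 + z * (- x\<^sup>2 + 2 * p * x * y + 2 * q * x * z
      + E * m\<^sup>2 * y\<^sup>2 + F * m * y * z + G * z\<^sup>2)" for x y z
  proof -
    have pq: "B * n * m = 2 * p" "C * n = 2 * q" by (simp_all add: p_def q_def)
    have "g1 (vector [x, y, z]) = (D * m^3) * y^3 + z * ((A * n\<^sup>2) * x\<^sup>2 + (B * n * m) * x * y
        + (C * n) * x * z + E * m\<^sup>2 * y\<^sup>2 + F * m * y * z + G * z\<^sup>2)"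
      unfolding g1(2) g(2) by algebra
    then show ?thesis
      unfolding m n pq by simp
  qed
  define r s where "r = (E * m\<^sup>2 + p\<^sup>2) / 3" and "s = F * m + 2 * p * q"
  have r: "E * m\<^sup>2 = 3 * r - p\<^sup>2" by (simp add: r_def field_simps)
  obtain g2 where g2: "linearly_equivalent f g2"
    "\<And>x y z. g2 (vector [x, y, z])
       = g1 (vector [1 * x + p * y + (q - p * r) * z, 0 * x + 1 * y + (- r) * z, 0 * x + 0 * y + 1 * z])"
    by (rule linear_substitution[OF g1(1), where ?a11.0 = 1 and ?a12.0 = p and ?a13.0 = "q - p * r"
          and ?a21.0 = 0 and ?a22.0 = 1 and ?a23.0 = "- r" and ?a31.0 = 0 and ?a32.0 = 0 and ?a33.0 = 1])
      simp_all
  have "g2 (vector [x, y, z]) = y^3 - x\<^sup>2 * z + (s - 3 * r\<^sup>2) * y * z\<^sup>2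
      + (G + q\<^sup>2 - s * r + 2 * r^3) * z^3" for x y z
    unfolding g2(2) g1' s_def r by algebra
  with g2(1) show thesis
    by (rule that)
qed

section \<open>Entire functions of the square root\<close>

text \<open>These are \<open>cosh (sqrt z)\<close> and \<open>sinh (sqrt z) / sqrt z\<close>. Both are even in \<open>sqrt z\<close>, so they are entire in
  \<open>z\<close>, and the power series avoid any choice of a branch of the square root.\<close>

definition cosh_sqrt :: "complex \<Rightarrow> complex" where
  "cosh_sqrt z = (\<Sum>n. inverse (fact (2 * n)) * z ^ n)"

definition sinhc_sqrt :: "complex \<Rightarrow> complex" where
  "sinhc_sqrt z = (\<Sum>n. inverse (fact (2 * n + 1)) * z ^ n)"

lemma cosh_sqrt_sums: "(\<lambda>n. inverse (fact (2 * n)) * (r\<^sup>2) ^ n) sums cosh (r :: complex)"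
proof -
  have "(\<lambda>n. if even (2 * n) then r ^ (2 * n) /\<^sub>R fact (2 * n) else 0) sums cosh r"
    by (subst sums_mono_reindex[where g = "\<lambda>n. 2 * n"])
      (auto simp: strict_mono_def intro: cosh_converges elim: evenE)
  then show ?thesis
    by (simp add: power_mult scaleR_conv_of_real)
qed

lemma sinhc_sqrt_sums:
  assumes "r \<noteq> 0"
  shows "(\<lambda>n. inverse (fact (2 * n + 1)) * (r\<^sup>2) ^ n) sums (sinh r / (r :: complex))"
proof -
  have "(\<lambda>n. if even (2 * n + 1) then 0 else r ^ (2 * n + 1) /\<^sub>R fact (2 * n + 1)) sums sinh r"
    by (subst sums_mono_reindex[where g = "\<lambda>n. 2 * n + 1"])
      (auto simp: strict_mono_def intro: sinh_converges elim: oddE)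
  then have "(\<lambda>n. r ^ (2 * n + 1) /\<^sub>R fact (2 * n + 1) / r) sums (sinh r / r)"
    by (intro sums_divide) simp
  moreover have "r ^ (2 * n + 1) /\<^sub>R fact (2 * n + 1) / r = inverse (fact (2 * n + 1)) * (r\<^sup>2) ^ n" for n
    using assms by (simp del: fact_Suc add: power_mult scaleR_conv_of_real)
  ultimately show ?thesis
    by (simp only:)
qed

lemma cosh_sqrt_power2: "cosh_sqrt (r\<^sup>2) = cosh r"
  unfolding cosh_sqrt_def using cosh_sqrt_sums by (rule sums_unique[symmetric])

lemma sinhc_sqrt_power2: "r * sinhc_sqrt (r\<^sup>2) = sinh r"
proof (cases "r = 0")
  case False
  then show ?thesis
    using sums_unique[OF sinhc_sqrt_sums[OF False]] by (simp add: sinhc_sqrt_def field_simps)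
qed simp

lemma sinhc_sqrt_0: "sinhc_sqrt 0 = 1"
  unfolding sinhc_sqrt_def powser_zero by simp

lemma cosh_sqrt_0: "cosh_sqrt 0 = 1"
  using cosh_sqrt_power2[of 0] by simp

text \<open>This is the relation between \<open>cosh\<close> and \<open>sinh\<close>, read as an entire solution of a Pell equation.\<close>

lemma cosh_sqrt_pell: "(cosh_sqrt z)\<^sup>2 = 1 + z * (sinhc_sqrt z)\<^sup>2"
proof -
  define r where "r = csqrt z"
  then have z: "z = r\<^sup>2" by simp
  have "(cosh_sqrt z)\<^sup>2 = (cosh r)\<^sup>2" "z * (sinhc_sqrt z)\<^sup>2 = (sinh r)\<^sup>2"
    unfolding z cosh_sqrt_power2 sinhc_sqrt_power2[symmetric] by (simp_all add: power_mult_distrib)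
  then show ?thesis
    by (simp add: cosh_square_eq)
qed

lemma field_differentiable_cosh_sqrt: "\<exists>D. (cosh_sqrt has_field_derivative D) (at z)"
proof -
  have "summable (\<lambda>n. inverse (fact (2 * n)) * y ^ n)" for y :: complex
    using cosh_sqrt_sums[of "csqrt y"] by (auto simp: sums_iff)
  from termdiffs_strong_converges_everywhere[OF this] show ?thesis
    unfolding cosh_sqrt_def[abs_def] by blast
qed

lemma field_differentiable_sinhc_sqrt: "\<exists>D. (sinhc_sqrt has_field_derivative D) (at z)"
proof -
  have "summable (\<lambda>n. inverse (fact (2 * n + 1)) * y ^ n)" for y :: complex
  proof (cases "y = 0")
    case False
    then show ?thesis
      using sinhc_sqrt_sums[of "csqrt y"] by (auto simp: sums_iff)
  qed (use summable_zero_power' in \<open>simp\<close>)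
  from termdiffs_strong_converges_everywhere[OF this] show ?thesis
    unfolding sinhc_sqrt_def[abs_def] by blast
qed

section \<open>Holomorphic functions of several variables\<close>

text \<open>Homogeneity of the real derivative over the complex numbers is all that has to be added, since the
  derivative is additive anyway; stated like this, it passes through the rules of differentiation.\<close>

definition complex_differentiable_at :: "(complex^'n \<Rightarrow> complex) \<Rightarrow> complex^'n \<Rightarrow> bool" where
  "complex_differentiable_at g z \<longleftrightarrow>
     (\<exists>D. (g has_derivative D) (at z) \<and> (\<forall>c v. D (c *s v) = c * D v))"

lemma complex_differentiable_at_const: "complex_differentiable_at (\<lambda>z. c) z"
  unfolding complex_differentiable_at_def by (intro exI[of _ "\<lambda>v. 0"]) simp

lemma complex_differentiable_at_coordinate: "complex_differentiable_at (\<lambda>z. z $ i) z"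
  unfolding complex_differentiable_at_def
  by (intro exI[of _ "\<lambda>v. v $ i"])
    (simp add: bounded_linear.has_derivative[OF bounded_linear_vec_nth has_derivative_ident])

lemma complex_differentiable_at_add:
  assumes "complex_differentiable_at f z" "complex_differentiable_at g z"
  shows "complex_differentiable_at (\<lambda>z. f z + g z) z"
proof -
  obtain D E where "(f has_derivative D) (at z)" "(g has_derivative E) (at z)"
    and "\<And>c v. D (c *s v) = c * D v" "\<And>c v. E (c *s v) = c * E v"
    using assms unfolding complex_differentiable_at_def by blast
  then show ?thesis
    unfolding complex_differentiable_at_def
    by (intro exI[of _ "\<lambda>v. D v + E v"]) (auto intro: has_derivative_add simp: distrib_left)
qed

lemma complex_differentiable_at_mult:
  assumes "complex_differentiable_at f z" "complex_differentiable_at g z"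
  shows "complex_differentiable_at (\<lambda>z. f z * g z) z"
proof -
  obtain D E where "(f has_derivative D) (at z)" "(g has_derivative E) (at z)"
    and "\<And>c v. D (c *s v) = c * D v" "\<And>c v. E (c *s v) = c * E v"
    using assms unfolding complex_differentiable_at_def by blast
  then show ?thesis
    unfolding complex_differentiable_at_def
    by (intro exI[of _ "\<lambda>v. f z * E v + D v * g z"] conjI has_derivative_mult)
      (simp_all add: algebra_simps)
qed

lemma complex_differentiable_at_compose:
  assumes "complex_differentiable_at f z" "\<exists>D. (h has_field_derivative D) (at (f z))"
  shows "complex_differentiable_at (\<lambda>z. h (f z)) z"
proof -
  obtain D E where D: "(f has_derivative D) (at z)" "\<And>c v. D (c *s v) = c * D v"
    and E: "(h has_derivative (\<lambda>v. E * v)) (at (f z))"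
    using assms unfolding complex_differentiable_at_def has_field_derivative_def by blast
  have "((\<lambda>z. h (f z)) has_derivative (\<lambda>v. E * D v)) (at z)"
    using has_derivative_compose[OF D(1) E] .
  then show ?thesis
    unfolding complex_differentiable_at_def using D(2)
    by (intro exI[of _ "\<lambda>v. E * D v"]) (simp add: mult.left_commute)
qed

lemma complex_differentiable_at_power:
  assumes "complex_differentiable_at f z"
  shows "complex_differentiable_at (\<lambda>z. f z ^ n) z"
  by (induction n)
    (simp_all add: complex_differentiable_at_const complex_differentiable_at_mult[OF assms])

lemma complex_differentiable_at_sum:
  "(\<And>i. i \<in> I \<Longrightarrow> complex_differentiable_at (f i) z) \<Longrightarrow>
   complex_differentiable_at (\<lambda>z. \<Sum>i\<in>I. f i z) z"
  by (induction I rule: infinite_finite_induct)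
    (simp_all add: complex_differentiable_at_const complex_differentiable_at_add)

lemma complex_differentiable_at_divide:
  assumes "complex_differentiable_at f z" "complex_differentiable_at g z" "g z \<noteq> 0"
  shows "complex_differentiable_at (\<lambda>z. f z / g z) z"
proof -
  have "\<exists>D. (inverse has_field_derivative D) (at (g z))"
    using DERIV_inverse[OF assms(3)] by blast
  from complex_differentiable_at_mult[OF assms(1) complex_differentiable_at_compose[OF assms(2) this]]
  show ?thesis
    by (simp add: divide_inverse)
qed

lemmas complex_differentiable_at_intros =
  complex_differentiable_at_const complex_differentiable_at_coordinate complex_differentiable_at_add
  complex_differentiable_at_mult complex_differentiable_at_power

lemma has_derivative_vec_componentwise:
  fixes f :: "'a::real_normed_vector \<Rightarrow> complex^'m"
  assumes "\<And>i. ((\<lambda>z. f z $ i) has_derivative D i) (at z)"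
  shows "(f has_derivative (\<lambda>v. \<chi> i. D i v)) (at z)"
proof -
  have expand: "(\<Sum>i\<in>UNIV. axis i (x i)) = (\<chi> i. x i)" for x :: "'m \<Rightarrow> complex"
    by (simp add: vec_eq_iff axis_def sum.delta')
  have "linear (axis i :: complex \<Rightarrow> complex^'m)" for i
    by (rule linearI) (simp_all add: vec_eq_iff axis_def)
  then have "bounded_linear (axis i :: complex \<Rightarrow> complex^'m)" for i
    by (simp add: linear_conv_bounded_linear)
  from bounded_linear.has_derivative[OF this assms] have "((\<lambda>z. \<Sum>i\<in>UNIV. axis i (f z $ i)) has_derivative (\<lambda>v. \<Sum>i\<in>UNIV. axis i (D i v))) (at z)"
    by (intro has_derivative_sum)
  moreover have "(\<lambda>z. \<Sum>i\<in>UNIV. axis i (f z $ i)) = f"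
    unfolding expand by (rule ext) (rule vec_lambda_eta)
  ultimately show ?thesis
    unfolding expand by simp
qed

text \<open>A complex linear derivative is given by a complex matrix, and it can be assembled from the
  components.\<close>

lemma complex_differentiable_at_vec:
  fixes f :: "complex^'n \<Rightarrow> complex^'m"
  assumes "\<And>i. complex_differentiable_at (\<lambda>z. f z $ i) z"
  shows "\<exists>A :: complex^'n^'m. (f has_derivative (\<lambda>v. A *v v)) (at z)"
proof -
  have "\<forall>i. \<exists>D. ((\<lambda>z. f z $ i) has_derivative D) (at z) \<and> (\<forall>c v. D (c *s v) = c * D v)"
    using assms unfolding complex_differentiable_at_def by blast
  then obtain D where D: "\<And>i. ((\<lambda>z. f z $ i) has_derivative D i) (at z)"
    "\<And>i c v. D i (c *s v) = c * D i v"
    by metis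
  define L where "L = (\<lambda>v. \<chi> i. D i v)"
  have L: "(f has_derivative L) (at z)"
    unfolding L_def using D(1) by (rule has_derivative_vec_componentwise)
  have "D i (v + w) = D i v + D i w" for i v w
    by (rule linear_add[OF bounded_linear.linear[OF has_derivative_bounded_linear[OF D(1)]]])
  then have "L (v + w) = L v + L w" "L (c *s v) = c *s L v" for c v w
    by (simp_all add: vec_eq_iff L_def D(2))
  then have "Vector_Spaces.linear (*s) (*s) L"
    by unfold_locales
  then have "matrix L *v v = L v" for v
    by (rule matrix_works)
  then have "(f has_derivative (\<lambda>v. matrix L *v v)) (at z)"
    using L by simp
  then show ?thesis
    by (rule exI[of _ "matrix L"])
qed

section \<open>Holomorphic maps to the projective plane\<close>

lemma proportional_refl: "x \<noteq> 0 \<Longrightarrow> proportional x x"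
  by (auto simp: proportional_def intro!: exI[of _ 1])

text \<open>In homogeneous coordinates the affine charts are quotients of components, so a nowhere zero
  holomorphic lift is enough.\<close>

lemma holomorphic_to_cp2_lift:
  fixes \<Psi> :: "complex^2 \<Rightarrow> complex^3"
  assumes nz: "\<And>z. \<Psi> z \<noteq> 0"
    and hol: "\<And>z j. complex_differentiable_at (\<lambda>z. \<Psi> z $ j) z"
  shows "holomorphic_to_cp2 (\<lambda>z. abs_cp2 (\<Psi> z))"
proof -
  have chart: "affine_chart i \<circ> (\<lambda>z. abs_cp2 (\<Psi> z))
      = (\<lambda>z. vector [\<Psi> z $ (i + 1) / \<Psi> z $ i, \<Psi> z $ (i + 2) / \<Psi> z $ i])" for i
    using nz by (simp add: fun_eq_iff affine_chart.abs_eq proportional_refl)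
  have "isCont \<Psi> z" for z
    using complex_differentiable_at_vec[OF hol, of z] by (auto dest: has_derivative_continuous)
  then have cont: "continuous_on UNIV \<Psi>"
    by (simp add: continuous_at_imp_continuous_on)
  have "continuous_on UNIV (\<lambda>z. abs_cp2 (\<Psi> z))"
    unfolding continuous_on_open_vimage[OF open_UNIV]
  proof (intro allI impI)
    fix U :: "cp2 set" assume "open U"
    then have "open {x. x \<noteq> 0 \<and> abs_cp2 x \<in> U}"
      by (simp add: open_cp2_def)
    from open_vimage[OF this cont] show "open ((\<lambda>z. abs_cp2 (\<Psi> z)) -` U \<inter> UNIV)"
      using nz by (simp add: vimage_def)
  qed
  moreover have "holomorphic_vec_on (affine_chart i \<circ> (\<lambda>z. abs_cp2 (\<Psi> z)))
      ((\<lambda>z. abs_cp2 (\<Psi> z)) -` affine_part i)" for i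
    unfolding holomorphic_vec_on_def chart
  proof
    fix z assume "z \<in> (\<lambda>z. abs_cp2 (\<Psi> z)) -` affine_part i"
    then have "\<Psi> z $ i \<noteq> 0"
      using nz by (simp add: affine_part_def nonzero_coord.abs_eq proportional_refl)
    then have "\<forall>k. complex_differentiable_at
        (\<lambda>z. (vector [\<Psi> z $ (i + 1) / \<Psi> z $ i, \<Psi> z $ (i + 2) / \<Psi> z $ i] :: complex^2) $ k) z"
      by (simp add: forall_2 complex_differentiable_at_divide hol)
    then show "\<exists>A :: complex^2^2. ((\<lambda>z. vector [\<Psi> z $ (i + 1) / \<Psi> z $ i, \<Psi> z $ (i + 2) / \<Psi> z $ i])
        has_derivative (\<lambda>v. A *v v)) (at z)"
      by (intro complex_differentiable_at_vec) simp
  qed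
  ultimately show ?thesis
    unfolding holomorphic_to_cp2_def by blast
qed

text \<open>The projection of \<open>\<complex>\<^sup>3 - {0}\<close> to the plane kills exactly the radial direction. Hence the Jacobian in
  a chart is invertible as soon as the derivative of the lift maps no nonzero vector to a multiple of the
  value of the lift.\<close>

lemma det_jacobian_chart_nonzero:
  fixes \<Psi> :: "complex^2 \<Rightarrow> complex^3"
  assumes nz: "\<And>z. \<Psi> z \<noteq> 0"
    and hol: "\<And>z j. complex_differentiable_at (\<lambda>z. \<Psi> z $ j) z"
    and D: "(\<Psi> has_derivative D) (at z0)"
    and transversal: "\<And>w c. D w = c *s \<Psi> z0 \<Longrightarrow> w = 0"
    and i: "\<Psi> z0 $ i \<noteq> 0"
  shows "det (jacobian (affine_chart i \<circ> (\<lambda>z. abs_cp2 (\<Psi> z))) (at z0)) \<noteq> 0"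
proof -
  let ?G = "affine_chart i \<circ> (\<lambda>z. abs_cp2 (\<Psi> z))"
  have chart: "?G = (\<lambda>z. vector [\<Psi> z $ (i + 1) / \<Psi> z $ i, \<Psi> z $ (i + 2) / \<Psi> z $ i])"
    using nz by (simp add: fun_eq_iff affine_chart.abs_eq proportional_refl)
  have "z0 \<in> (\<lambda>z. abs_cp2 (\<Psi> z)) -` affine_part i"
    using nz i by (simp add: affine_part_def nonzero_coord.abs_eq proportional_refl)
  then obtain A :: "complex^2^2" where A: "(?G has_derivative (\<lambda>v. A *v v)) (at z0)"
    using holomorphic_to_cp2_lift[OF nz hol] unfolding holomorphic_to_cp2_def holomorphic_vec_on_def
    by blast
  have jac: "jacobian ?G (at z0) = A"
    unfolding jacobian_def frechet_derivative_at[OF A, symmetric] by (rule matrix_of_matrix_vector_mul)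
  have Dj: "((\<lambda>z. \<Psi> z $ j) has_derivative (\<lambda>v. D v $ j)) (at z0)" for j
    using D by (rule bounded_linear.has_derivative[OF bounded_linear_vec_nth])
  have "w = 0" if w: "A *v w = 0" for w
  proof -
    \<comment> \<open>By the quotient rule, a vector in the kernel does not change the ratios of the components.\<close>
    have quotient: "D w $ j * \<Psi> z0 $ i = D w $ i * \<Psi> z0 $ j"
      if k: "\<And>z. ?G z $ k = \<Psi> z $ j / \<Psi> z $ i" for j k
    proof -
      have "((\<lambda>z. \<Psi> z $ j / \<Psi> z $ i) has_derivative (\<lambda>v. (A *v v) $ k)) (at z0)"
        using bounded_linear.has_derivative[OF bounded_linear_vec_nth[of k] A] by (simp only: k)
      moreover have "((\<lambda>z. \<Psi> z $ j / \<Psi> z $ i) has_derivative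
          (\<lambda>v. (D v $ j * \<Psi> z0 $ i - \<Psi> z0 $ j * D v $ i) / (\<Psi> z0 $ i * \<Psi> z0 $ i))) (at z0)"
        by (rule has_derivative_divide'[OF Dj Dj i])
      ultimately have "(\<lambda>v. (A *v v) $ k)
          = (\<lambda>v. (D v $ j * \<Psi> z0 $ i - \<Psi> z0 $ j * D v $ i) / (\<Psi> z0 $ i * \<Psi> z0 $ i))"
        by (rule has_derivative_unique)
      from fun_cong[OF this, of w] show ?thesis
        using w i by simp
    qed
    have near: "D w $ (i + 1) * \<Psi> z0 $ i = D w $ i * \<Psi> z0 $ (i + 1)"
      by (rule quotient[where k = 1]) (simp add: chart)
    have far: "D w $ (i + 2) * \<Psi> z0 $ i = D w $ i * \<Psi> z0 $ (i + 2)"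
      by (rule quotient[where k = 2]) (simp add: chart)
    have "D w $ j = D w $ i / \<Psi> z0 $ i * \<Psi> z0 $ j" for j
    proof -
      consider "j = i" | "j = i + 1" | "j = i + 2"
        using exhaust_3[of i] exhaust_3[of j] by fastforce
      then have "D w $ j * \<Psi> z0 $ i = D w $ i * \<Psi> z0 $ j"
        by cases (simp_all only: near far)
      then show ?thesis
        using i by (simp add: divide_simps)
    qed
    then have "D w = (D w $ i / \<Psi> z0 $ i) *s \<Psi> z0"
      unfolding vec_eq_iff vector_smult_component by (rule allI)
    then show ?thesis
      by (rule transversal)
  qed
  then have "invertible A"
    by (simp add: invertible_left_inverse matrix_left_invertible_ker)
  then show ?thesis
    by (simp add: jac invertible_det_nz)
qed

section \<open>The dominating map\<close>

text \<open>Let \<open>f = y\<^sup>3 - x\<^sup>2 z + a y z\<^sup>2 + b z\<^sup>3\<close>. The plane \<open>y = 1 + 3 u\<^sup>2 z\<close> meets the surface \<open>f = 1\<close> in the line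
  \<open>y = 1, z = 0\<close> and in the conic \<open>x\<^sup>2 = 9 u\<^sup>2 + B z + \<delta> z\<^sup>2\<close>, where \<open>B\<close> is \<open>conic_slope a u\<close> and \<open>\<delta>\<close> is
  \<open>conic_discriminant a b u\<close>. The line parametrizes the conics: it meets this one at \<open>x = 3 u\<close>.\<close>

definition conic_slope :: "complex \<Rightarrow> complex \<Rightarrow> complex" where
  "conic_slope a u = a + 27 * u ^ 4"

definition conic_discriminant :: "complex \<Rightarrow> complex \<Rightarrow> complex \<Rightarrow> complex" where
  "conic_discriminant a b u = b + 3 * a * u\<^sup>2 + 27 * u ^ 6"

text \<open>A point \<open>w\<close> of \<open>\<complex>\<^sup>2\<close> consists of the time \<open>s = w $ 1\<close> and the parameter \<open>u = w $ 2\<close> of the conic. In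
  these terms \<open>flow_c\<close> is \<open>cosh (s * sqrt \<delta>)\<close> and \<open>flow_p\<close> is \<open>sinh (s * sqrt \<delta>) / sqrt \<delta>\<close>.\<close>

definition flow_c :: "complex \<Rightarrow> complex \<Rightarrow> complex^2 \<Rightarrow> complex" where
  "flow_c a b w = cosh_sqrt (conic_discriminant a b (w $ 2) * (w $ 1)\<^sup>2)"

definition flow_p :: "complex \<Rightarrow> complex \<Rightarrow> complex^2 \<Rightarrow> complex" where
  "flow_p a b w = w $ 1 * sinhc_sqrt (conic_discriminant a b (w $ 2) * (w $ 1)\<^sup>2)"

text \<open>The functions \<open>conic_flow_x\<close> and \<open>conic_flow_z\<close> solve the affine system \<open>z' = 2 x\<close>, \<open>x' = B + 2 \<delta> z\<close> in the
  time \<open>s\<close> with initial values \<open>x = 3 u\<close>, \<open>z = 0\<close>. It is the Hamiltonian system of the equation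
  \<open>x\<^sup>2 - B z - \<delta> z\<^sup>2\<close> of the conic, which is therefore preserved.\<close>

definition conic_flow_z :: "complex \<Rightarrow> complex \<Rightarrow> complex^2 \<Rightarrow> complex" where
  "conic_flow_z a b w = 6 * w $ 2 * flow_p a b w * flow_c a b w + conic_slope a (w $ 2) * (flow_p a b w)\<^sup>2"

definition conic_flow_x :: "complex \<Rightarrow> complex \<Rightarrow> complex^2 \<Rightarrow> complex" where
  "conic_flow_x a b w = 3 * w $ 2 * ((flow_c a b w)\<^sup>2 + conic_discriminant a b (w $ 2) * (flow_p a b w)\<^sup>2)
     + conic_slope a (w $ 2) * flow_p a b w * flow_c a b w"

definition conic_flow :: "complex \<Rightarrow> complex \<Rightarrow> complex^2 \<Rightarrow> complex^3" where
  "conic_flow a b w = vector [conic_flow_x a b w, 1 + 3 * (w $ 2)\<^sup>2 * conic_flow_z a b w, conic_flow_z a b w]"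

lemma flow_pell: "(flow_c a b w)\<^sup>2 = 1 + conic_discriminant a b (w $ 2) * (flow_p a b w)\<^sup>2"
  by (simp add: flow_c_def flow_p_def cosh_sqrt_pell power_mult_distrib mult.assoc)

lemma conic_flow_on_conic:
  "(conic_flow_x a b w)\<^sup>2 = 9 * (w $ 2)\<^sup>2 + conic_slope a (w $ 2) * conic_flow_z a b w
     + conic_discriminant a b (w $ 2) * (conic_flow_z a b w)\<^sup>2"
  unfolding conic_flow_x_def conic_flow_z_def using flow_pell[of a b w] by algebra

text \<open>Substituting \<open>y = 1 + 3 u\<^sup>2 z\<close> into \<open>f - 1\<close> and dividing by \<open>z\<close> leaves the equation of the conic.\<close>

lemma conic_flow_in_surface:
  assumes g: "\<And>x y z. g (vector [x, y, z] :: complex^3) = y^3 - x\<^sup>2 * z + a * y * z\<^sup>2 + b * z^3"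
  shows "g (conic_flow a b w) = (1 :: complex)"
  unfolding conic_flow_def g conic_flow_on_conic conic_slope_def conic_discriminant_def
  by algebra

lemma complex_differentiable_at_conic_flow: "complex_differentiable_at (\<lambda>w. conic_flow a b w $ j) w"
proof -
  note intros = complex_differentiable_at_intros
  have c: "complex_differentiable_at (flow_c a b) w" for w
    unfolding flow_c_def[abs_def] conic_discriminant_def
    by (intro complex_differentiable_at_compose[OF _ field_differentiable_cosh_sqrt] intros)
  have p: "complex_differentiable_at (flow_p a b) w" for w
    unfolding flow_p_def[abs_def] conic_discriminant_def
    by (intro intros complex_differentiable_at_compose[OF _ field_differentiable_sinhc_sqrt])
  have x: "complex_differentiable_at (conic_flow_x a b) w"
    and z: "complex_differentiable_at (conic_flow_z a b) w"
    unfolding conic_flow_x_def[abs_def] conic_flow_z_def[abs_def] conic_slope_def conic_discriminant_def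
    by (intro intros c p)+
  have "complex_differentiable_at (\<lambda>w. 1 + 3 * (w $ 2)\<^sup>2 * conic_flow_z a b w) w"
    by (intro intros z)
  with x z have "\<forall>j. complex_differentiable_at (\<lambda>w. conic_flow a b w $ j) w"
    by (simp add: forall_3 conic_flow_def)
  then show ?thesis ..
qed

text \<open>At time \<open>s = 0\<close> the map runs along the line \<open>y = 1, z = 0\<close> when \<open>u\<close> varies, and along the conic when \<open>s\<close>
  varies. For \<open>u = 1\<close> these two directions and the radial one are independent, because the conic then
  leaves the line transversally. The argument of the two entire functions contains \<open>s\<^sup>2\<close>, so it does not
  contribute at first order.\<close>

lemma conic_flow_derivative:
  defines "w0 \<equiv> vector [0, 1] :: complex^2"
  shows "conic_flow a b w0 = vector [3, 1, 0]"
    and "(conic_flow a b has_derivative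
      (\<lambda>v. vector [(a + 27) * v $ 1 + 3 * v $ 2, 18 * v $ 1, 6 * v $ 1])) (at w0)"
proof -
  have w0: "w0 $ 1 = 0" "w0 $ 2 = 1"
    by (simp_all add: w0_def)
  have vals: "flow_p a b w0 = 0" "flow_c a b w0 = 1"
    by (simp_all add: flow_p_def flow_c_def w0 cosh_sqrt_0)
  then have z0: "conic_flow_z a b w0 = 0" and x0: "conic_flow_x a b w0 = 3"
    by (simp_all add: conic_flow_z_def conic_flow_x_def w0)
  then show "conic_flow a b w0 = vector [3, 1, 0]"
    by (simp add: conic_flow_def)
  have coord: "((\<lambda>w :: complex^2. w $ i) has_derivative (\<lambda>v. v $ i)) (at w0)" for i
    by (rule bounded_linear.has_derivative[OF bounded_linear_vec_nth has_derivative_ident])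
  have "complex_differentiable_at (\<lambda>w. conic_discriminant a b (w $ 2)) w0"
    unfolding conic_discriminant_def by (intro complex_differentiable_at_intros)
  then obtain \<Delta> where \<Delta>: "((\<lambda>w. conic_discriminant a b (w $ 2)) has_derivative \<Delta>) (at w0)"
    unfolding complex_differentiable_at_def by blast
  have arg: "((\<lambda>w. conic_discriminant a b (w $ 2) * (w $ 1)\<^sup>2) has_derivative (\<lambda>v. 0)) (at w0)"
    by (rule has_derivative_eq_rhs[OF has_derivative_mult[OF \<Delta> has_derivative_power[OF coord]]])
      (simp add: w0)
  have c: "(flow_c a b has_derivative (\<lambda>v. 0)) (at w0)"
  proof -
    obtain E where E: "(cosh_sqrt has_derivative (\<lambda>v. E * v)) (at (conic_discriminant a b (w0 $ 2) * (w0 $ 1)\<^sup>2))"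
      using field_differentiable_cosh_sqrt unfolding has_field_derivative_def by blast
    show ?thesis
      using has_derivative_compose[OF arg E] by (simp add: flow_c_def[abs_def])
  qed
  have p: "(flow_p a b has_derivative (\<lambda>v. v $ 1)) (at w0)"
  proof -
    obtain E where E: "(sinhc_sqrt has_derivative (\<lambda>v. E * v)) (at (conic_discriminant a b (w0 $ 2) * (w0 $ 1)\<^sup>2))"
      using field_differentiable_sinhc_sqrt unfolding has_field_derivative_def by blast
    show ?thesis
      using has_derivative_mult[OF coord[of 1] has_derivative_compose[OF arg E]]
      by (simp add: flow_p_def[abs_def] w0 sinhc_sqrt_0)
  qed
  have slope: "((\<lambda>w :: complex^2. conic_slope a (w $ 2)) has_derivative (\<lambda>v. 108 * v $ 2)) (at w0)"
    unfolding conic_slope_def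
    by (rule derivative_eq_intros coord refl)+ (simp add: w0)
  have z: "(conic_flow_z a b has_derivative (\<lambda>v. 6 * v $ 1)) (at w0)"
    unfolding conic_flow_z_def[abs_def]
    by (rule derivative_eq_intros coord c p slope refl)+ (simp add: w0 vals)
  have x: "(conic_flow_x a b has_derivative (\<lambda>v. (a + 27) * v $ 1 + 3 * v $ 2)) (at w0)"
    unfolding conic_flow_x_def[abs_def]
    by (rule derivative_eq_intros coord c p slope \<Delta> refl)+
      (simp add: w0 vals conic_slope_def algebra_simps)
  have y: "((\<lambda>w. 1 + 3 * (w $ 2)\<^sup>2 * conic_flow_z a b w) has_derivative (\<lambda>v. 18 * v $ 1)) (at w0)"
    by (rule derivative_eq_intros coord z refl)+ (simp add: w0 z0)
  define L where "L = (\<lambda>i :: 3. \<lambda>v :: complex^2. (vector [(a + 27) * v $ 1 + 3 * v $ 2, 18 * v $ 1, 6 * v $ 1] :: complex^3) $ i)"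
  have "\<forall>i. ((\<lambda>w. conic_flow a b w $ i) has_derivative L i) (at w0)"
    using x y z by (simp add: forall_3 conic_flow_def L_def)
  then have "(conic_flow a b has_derivative (\<lambda>v. \<chi> i. L i v)) (at w0)"
    by (intro has_derivative_vec_componentwise) simp
  then show "(conic_flow a b has_derivative
      (\<lambda>v. vector [(a + 27) * v $ 1 + 3 * v $ 2, 18 * v $ 1, 6 * v $ 1])) (at w0)"
    by (simp add: L_def vec_lambda_eta)
qed

text \<open>The lift takes values in the level set where the equation of the curve equals one, so it is
  nowhere zero and its image in the plane avoids the curve.\<close>

theorem proposition5p1:
  fixes C :: "cp2 set"
  assumes "smooth_cubic_curve C"
  shows "dominable_by_C2 (UNIV - C)"
proof -
  obtain q where q: "nonsingular_form 3 q" and C: "C = plane_curve 3 q"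
    using assms unfolding smooth_cubic_curve_def by blast
  obtain g a b where equiv: "linearly_equivalent (form_eval 3 q) g"
    and g: "\<And>x y z. g (vector [x, y, z]) = y^3 - x\<^sup>2 * z + a * y * z\<^sup>2 + b * z^3"
    by (rule nonsingular_cubic_weierstrass_form[OF cubic_form_form_eval nonsingular_cone_form_eval[OF q]])
      (rule that; assumption)
  obtain A :: "complex^3^3" where "invertible A" and gA: "\<And>x. g x = form_eval 3 q (A *v x)"
    using equiv unfolding linearly_equivalent_def by blast
  then obtain A' where A': "A' ** A = mat 1"
    unfolding invertible_def by blast
  define \<Psi> where "\<Psi> w = A *v conic_flow a b w" for w
  have one: "form_eval 3 q (\<Psi> w) = 1" for w
    using conic_flow_in_surface[OF g] by (simp add: \<Psi>_def gA)
  have nz: "\<Psi> w \<noteq> 0" for w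
    using one[of w] form_eval_scale[of 3 q 0 0] by auto
  have hol: "complex_differentiable_at (\<lambda>w. \<Psi> w $ j) w" for w j
    unfolding \<Psi>_def matrix_vector_mult_def vec_lambda_beta
    by (intro complex_differentiable_at_sum complex_differentiable_at_mult
        complex_differentiable_at_const complex_differentiable_at_conic_flow)
  define w0 :: "complex^2" where "w0 = vector [0, 1]"
  define D where "D = (\<lambda>v :: complex^2. vector [(a + 27) * v $ 1 + 3 * v $ 2, 18 * v $ 1, 6 * v $ 1] :: complex^3)"
  have flow: "conic_flow a b w0 = vector [3, 1, 0]" "(conic_flow a b has_derivative D) (at w0)"
    unfolding w0_def D_def by (rule conic_flow_derivative)+
  have "bounded_linear ((*v) A)"
    by (simp add: linear_conv_bounded_linear[symmetric] linearI matrix_vector_right_distrib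
        vec_eq_iff matrix_vector_mult_def scaleR_sum_right)
  from bounded_linear.has_derivative[OF this flow(2)]
  have der: "(\<Psi> has_derivative (\<lambda>v. A *v D v)) (at w0)"
    by (simp add: \<Psi>_def[abs_def])
  have transversal: "v = 0" if "A *v D v = c *s \<Psi> w0" for v c
  proof -
    have "A *v D v = A *v (c *s vector [3, 1, 0])"
      using that by (simp add: \<Psi>_def flow(1) vector_scalar_commute)
    then have "D v = c *s vector [3, 1, 0]"
      using A' by (metis matrix_vector_mul_assoc matrix_vector_mul_lid)
    then show "v = 0"
      by (auto simp add: D_def vec_eq_iff forall_3 forall_2)
  qed
  obtain i where i: "\<Psi> w0 $ i \<noteq> 0"
    using nz[of w0] by (auto simp: vec_eq_iff)
  have "det (jacobian (affine_chart i \<circ> (\<lambda>w. abs_cp2 (\<Psi> w))) (at w0)) \<noteq> 0"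
    using det_jacobian_chart_nonzero[OF nz hol der transversal i] .
  moreover have "abs_cp2 (\<Psi> w0) \<in> affine_part i"
    using i nz by (simp add: affine_part_def nonzero_coord.abs_eq proportional_refl)
  moreover have "range (\<lambda>w. abs_cp2 (\<Psi> w)) \<subseteq> UNIV - C"
    using nz one by (auto simp: C plane_curve_def form_vanishes_at.abs_eq proportional_refl)
  ultimately show ?thesis
    unfolding dominable_by_C2_def using holomorphic_to_cp2_lift[OF nz hol] by blast
qed

end
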